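(* For every positive integer $N$ there exist a set $V\subset\mathbb{R}$ with $|V|=2^N$ and a graph $G=(V,E)$ with $|E|=N2^{N-1}$ such that no subset of $V$ of size greater than $2$ is reconstructible from $G$.
   Context: Given a finite set $V\subset\mathbb{R}$ and a graph $G$ on vertex set $V$, a subset $V'\subseteq V$ is reconstructible from $G$ if for every injective map $g:V\to\mathbb{R}$ with $|g(x)-g(y)|=|x-y|$ for every edge $xy$ of $G$, we have $|g(u)-g(v)|=|u-v|$ for all $u,v\in V'$. *)

theory Defs
  imports Complex_Main
begin

definition simple_graph :: "'a set \<Rightarrow> 'a set set \<Rightarrow> bool" where
  "simple_graph V E \<longleftrightarrow> finite V \<and> (\<forall>e\<in>E. e \<subseteq> V \<and> card e = 2)"

text \<open>Maps from \<open>V\<close> to the reals are represented by total functions on the reals; only their values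
  on \<open>V\<close> matter, since the edges of a graph on \<open>V\<close> are subsets of \<open>V\<close>.\<close>

definition reconstructible :: "real set \<Rightarrow> real set set \<Rightarrow> real set \<Rightarrow> bool" where
  "reconstructible V E V' \<longleftrightarrow> V' \<subseteq> V \<and>
     (\<forall>g :: real \<Rightarrow> real.
        inj_on g V \<and> (\<forall>x\<in>V. \<forall>y\<in>V. {x, y} \<in> E \<longrightarrow> \<bar>g x - g y\<bar> = \<bar>x - y\<bar>)
        \<longrightarrow> (\<forall>u\<in>V'. \<forall>v\<in>V'. \<bar>g u - g v\<bar> = \<bar>u - v\<bar>))"

end

theory Submission
  imports Defs
begin

text \<open>Project the cube graph on the subsets \<open>S\<close> of \<open>{..<N}\<close> to the line by
  \<open>S \<mapsto> (\<Sum>k\<in>S. 3 ^ k)\<close>. Replacing \<open>3 ^ i\<close> by \<open>- 3 ^ i\<close> for a single \<open>i\<close> preserves all edge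
  lengths, and the resulting map is injective by uniqueness of balanced ternary expansions. The same
  uniqueness shows that the flip changes the distance between \<open>S\<close> and \<open>T\<close> as soon as they differ in
  \<open>i\<close> and in some further coordinate. So a reconstructible set consists of pairwise adjacent vertices
  of the cube, which is triangle-free.\<close>

text \<open>The extreme case is all digits equal to 1, where the geometric sum is
  \<open>(3 ^ n - 1) / 2\<close>. The bound says that the lower places together stay below half of
  the next place value.\<close>

lemma balanced_ternary_bound:
  fixes c :: "nat \<Rightarrow> real"
  assumes "\<And>k. k < n \<Longrightarrow> \<bar>c k\<bar> \<le> 1"
  shows "2 * \<bar>\<Sum>k<n. c k * 3 ^ k\<bar> < 3 ^ n"
  using assms
proof (induction n)
  case (Suc n)
  have "\<bar>c n * 3 ^ n\<bar> \<le> 1 * 3 ^ n"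
    unfolding abs_mult using Suc.prems[of n] by (intro mult_mono) auto
  moreover have "2 * \<bar>\<Sum>k<n. c k * 3 ^ k\<bar> < 3 ^ n"
    using Suc by simp
  moreover have "\<bar>\<Sum>k<Suc n. c k * 3 ^ k\<bar> \<le> \<bar>\<Sum>k<n. c k * 3 ^ k\<bar> + \<bar>c n * 3 ^ n\<bar>"
    unfolding sum.lessThan_Suc by (rule abs_triangle_ineq)
  ultimately show ?case
    unfolding power_Suc by linarith
qed simp

text \<open>A nonzero leading digit would contribute \<open>3 ^ n\<close> in absolute value, too
  much for the lower places to cancel. So the leading digit vanishes, and induction handles the
  rest.\<close>

lemma balanced_ternary_eq_0:
  fixes c :: "nat \<Rightarrow> real"
  assumes "\<And>k. k < n \<Longrightarrow> c k \<in> {-1, 0, 1}" and "(\<Sum>k<n. c k * 3 ^ k) = 0" and "i < n"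
  shows "c i = 0"
  using assms
proof (induction n)
  case (Suc n)
  have "\<bar>c k\<bar> \<le> 1" if "k < n" for k
    using Suc.prems(1)[of k] that by auto
  then have "2 * \<bar>\<Sum>k<n. c k * 3 ^ k\<bar> < 3 ^ n"
    by (rule balanced_ternary_bound)
  then have "c n = 0"
    using Suc.prems(1)[of n] Suc.prems(2) by auto
  then show ?case
    using Suc by (cases "i = n") auto
qed simp

text \<open>The signs are a parameter so that the embedding of the cube (all signs 1) and its
  flipped competitors are treated at once.\<close>

definition ternary_sum :: "(nat \<Rightarrow> real) \<Rightarrow> nat set \<Rightarrow> real" where
  "ternary_sum s A = (\<Sum>k\<in>A. s k * 3 ^ k)"

definition flip_sign :: "nat \<Rightarrow> nat \<Rightarrow> real" where
  "flip_sign i k = (if k = i then -1 else 1)"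

lemma ternary_sum_diff:
  assumes "A \<subseteq> {..<n}" "B \<subseteq> {..<n}"
  shows "ternary_sum s A - ternary_sum s B
    = (\<Sum>k<n. s k * (of_bool (k \<in> A) - of_bool (k \<in> B)) * 3 ^ k)"
proof -
  have "ternary_sum s C = (\<Sum>k<n. s k * of_bool (k \<in> C) * 3 ^ k)" if "C \<subseteq> {..<n}" for C
    unfolding ternary_sum_def using that by (intro sum.mono_neutral_cong_left) auto
  then show ?thesis
    using assms by (simp add: sum_subtractf algebra_simps)
qed

text \<open>Along a cube edge only one place changes, so for signs \<plusminus>1 the edge length
  does not depend on \<open>s\<close>.\<close>

lemma ternary_sum_insert_diff:
  assumes "finite A" "i \<notin> A"
  shows "ternary_sum s (insert i A) - ternary_sum s A = s i * 3 ^ i"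
  using assms by (simp add: ternary_sum_def)

lemma inj_on_ternary_sum:
  assumes "\<And>k. s k \<in> {-1, 1}"
  shows "inj_on (ternary_sum s) (Pow {..<n})"
proof (rule inj_onI)
  fix A B
  assume AB: "A \<in> Pow {..<n}" "B \<in> Pow {..<n}" and eq: "ternary_sum s A = ternary_sum s B"
  have "s k * (of_bool (k \<in> A) - of_bool (k \<in> B)) = 0" if "k < n" for k
  proof (rule balanced_ternary_eq_0[where c = "\<lambda>k. s k * (of_bool (k \<in> A) - of_bool (k \<in> B))"])
    show "s j * (of_bool (j \<in> A) - of_bool (j \<in> B)) \<in> {-1, 0, 1}" for j
      using assms[of j] by auto
    show "(\<Sum>k<n. s k * (of_bool (k \<in> A) - of_bool (k \<in> B)) * 3 ^ k) = 0"
      using ternary_sum_diff[of A n B s] AB eq by simp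
  qed (fact that)
  moreover have "s k \<noteq> 0" for k
    using assms[of k] by auto
  ultimately have "k \<in> A \<longleftrightarrow> k \<in> B" if "k < n" for k
    using that by (fastforce split: if_splits simp: of_bool_def)
  then show "A = B"
    using AB by blast
qed

lemma ternary_sum_flip_sign_neq:
  assumes AB: "A \<subseteq> {..<n}" "B \<subseteq> {..<n}"
    and ij: "(i \<in> A) \<noteq> (i \<in> B)" "(j \<in> A) \<noteq> (j \<in> B)" "i \<noteq> j"
  shows "\<bar>ternary_sum (flip_sign i) A - ternary_sum (flip_sign i) B\<bar>
    \<noteq> \<bar>ternary_sum (\<lambda>_. 1) A - ternary_sum (\<lambda>_. 1) B\<bar>"
proof
  define w :: "nat \<Rightarrow> real" where "w k = of_bool (k \<in> A) - of_bool (k \<in> B)" for k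
  define x where "x = (\<Sum>k<n. w k * 3 ^ k)"
  define y where "y = (\<Sum>k<n. flip_sign i k * w k * 3 ^ k)"
  have w: "w k \<in> {-1, 0, 1}" for k
    by (simp add: w_def)
  have "w i \<noteq> 0" "w j \<noteq> 0" "i < n" "j < n"
    using ij AB by (auto simp: w_def)
  \<comment> \<open>If \<bar>x\<bar> = \<bar>y\<bar>, then x - y or x + y vanishes. The flip negates
    only the digit at \<open>i\<close>, so x - y retains just that digit, doubled. It is written as
    a full expansion to fit \<open>balanced_ternary_eq_0\<close>.\<close>
  have "x - y = 2 * (\<Sum>k<n. (if k = i then w k else 0) * 3 ^ k)"
    unfolding x_def y_def sum_subtractf[symmetric] sum_distrib_left
    by (intro sum.cong) (auto simp: flip_sign_def)
  moreover have "(\<Sum>k<n. (if k = i then w k else 0) * 3 ^ k) \<noteq> 0"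
  proof
    assume sum: "(\<Sum>k<n. (if k = i then w k else 0) * 3 ^ k) = 0"
    have "(if k = i then w k else 0) \<in> {-1, 0, 1}" for k
      using w[of k] by auto
    from balanced_ternary_eq_0[OF this sum \<open>i < n\<close>] show False
      using \<open>w i \<noteq> 0\<close> by simp
  qed
  ultimately have "x \<noteq> y"
    by simp
  \<comment> \<open>In x + y the digit at \<open>i\<close> cancels and the others double. The second
    coordinate \<open>j\<close> keeps this expansion from vanishing.\<close>
  have "x + y = 2 * (\<Sum>k<n. (if k = i then 0 else w k) * 3 ^ k)"
    unfolding x_def y_def sum.distrib[symmetric] sum_distrib_left
    by (intro sum.cong) (auto simp: flip_sign_def)
  moreover have "(\<Sum>k<n. (if k = i then 0 else w k) * 3 ^ k) \<noteq> 0"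
  proof
    assume sum: "(\<Sum>k<n. (if k = i then 0 else w k) * 3 ^ k) = 0"
    have "(if k = i then 0 else w k) \<in> {-1, 0, 1}" for k
      using w[of k] by auto
    from balanced_ternary_eq_0[OF this sum \<open>j < n\<close>] show False
      using \<open>w j \<noteq> 0\<close> \<open>i \<noteq> j\<close> by simp
  qed
  ultimately have "x \<noteq> - y"
    by linarith
  assume "\<bar>ternary_sum (flip_sign i) A - ternary_sum (flip_sign i) B\<bar>
    = \<bar>ternary_sum (\<lambda>_. 1) A - ternary_sum (\<lambda>_. 1) B\<bar>"
  then have "\<bar>y\<bar> = \<bar>x\<bar>"
    by (simp add: ternary_sum_diff[OF AB] x_def y_def w_def)
  with \<open>x \<noteq> y\<close> \<open>x \<noteq> - y\<close> show False
    by (simp add: abs_eq_iff)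
qed

text \<open>Each edge is indexed by its direction \<open>i\<close> and its lower endpoint
  \<open>A\<close>, so that it arises exactly once.\<close>

definition cube_edges :: "nat \<Rightarrow> nat set set set" where
  "cube_edges n = (\<lambda>(i, A). {A, insert i A}) ` (SIGMA i:{..<n}. Pow ({..<n} - {i}))"

lemma card_cube_edges: "card (cube_edges n) = n * 2 ^ (n - 1)"
proof -
  have "inj_on (\<lambda>(i, A). {A, insert i A}) (SIGMA i:{..<n}. Pow ({..<n} - {i}))"
    by (rule inj_onI) (clarsimp simp: doubleton_eq_iff, blast)
  then have "card (cube_edges n) = (\<Sum>i<n. card (Pow ({..<n} - {i})))"
    by (simp add: cube_edges_def card_image)
  also have "\<dots> = n * 2 ^ (n - 1)"
    by (simp add: card_Pow)
  finally show ?thesis .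
qed

text \<open>This is triangle-freeness of the cube. If one coordinate separates A from both B and C,
  then B and C agree there, so a coordinate separating B from C is a new one and also separates A
  from B or from C. If \<open>i\<close> and \<open>j\<close> differ and neither separates both
  pairs, then both separate B from C.\<close>

lemma three_sets_differ_twice:
  assumes "A \<noteq> B" "B \<noteq> C" "A \<noteq> C"
  obtains S T i j where "S \<in> {A, B, C}" "T \<in> {A, B, C}"
    "(i \<in> S) \<noteq> (i \<in> T)" "(j \<in> S) \<noteq> (j \<in> T)" "i \<noteq> j"
proof -
  obtain i where i: "(i \<in> A) \<noteq> (i \<in> B)"
    using assms by blast
  obtain j where j: "(j \<in> A) \<noteq> (j \<in> C)"
    using assms by blast
  obtain k where k: "(k \<in> B) \<noteq> (k \<in> C)"
    using assms by blast
  show thesis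
  proof (cases "i = j")
    case True
    then have "k \<noteq> i" "(k \<in> A) \<noteq> (k \<in> B) \<or> (k \<in> A) \<noteq> (k \<in> C)"
      using i j k by blast+
    then show thesis
      using that[of A B i k] that[of A C i k] i j True by blast
  next
    case False
    then show thesis
      using that[of A B i j] that[of A C i j] that[of B C i j] i j by blast
  qed
qed

theorem theorem1p4:
  fixes N :: nat
  assumes "N \<ge> 1"
  shows "\<exists>(V :: real set) (E :: real set set).
    simple_graph V E \<and> card V = 2 ^ N \<and> card E = N * 2 ^ (N - 1) \<and>
    (\<forall>V'. V' \<subseteq> V \<and> card V' > 2 \<longrightarrow> \<not> reconstructible V E V')"
proof -
  let ?P = "Pow {..<N}"
  define f where "f = ternary_sum (\<lambda>_. 1)"
  define V where "V = f ` ?P"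
  define E where "E = (`) f ` cube_edges N"
  have inj: "inj_on f ?P"
    unfolding f_def by (rule inj_on_ternary_sum) simp
  have edges: "cube_edges N \<subseteq> Pow ?P"
    by (auto simp: cube_edges_def)
  have "card e = 2" if "e \<in> E" for e
  proof -
    obtain c where c: "c \<in> cube_edges N" "e = f ` c"
      using \<open>e \<in> E\<close> unfolding E_def by blast
    then have "card e = card c"
      using edges inj by (metis PowD card_image inj_on_subset subsetD)
    also have "card c = 2"
      using c by (auto simp: cube_edges_def card_2_iff)
    finally show ?thesis .
  qed
  then have "simple_graph V E"
    using edges unfolding simple_graph_def V_def E_def by blast
  moreover have "card V = 2 ^ N"
    by (simp add: V_def card_image[OF inj] card_Pow)
  \<comment> \<open>Taking images under the injection \<open>f\<close> is itself injective on
    subsets of its domain, so distinct cube edges stay distinct.\<close>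
  moreover have "card E = N * 2 ^ (N - 1)"
    using card_image[OF inj_on_subset[OF inj_on_image_Pow[OF inj] edges]]
    by (simp add: E_def card_cube_edges)
  moreover have "\<not> reconstructible V E V'" if V': "V' \<subseteq> V" "card V' > 2" for V'
  proof
    assume rec: "reconstructible V E V'"
    have "3 \<le> card V'"
      using V' by simp
    then obtain W where "W \<subseteq> V'" "card W = 3"
      by (rule obtain_subset_with_card_n)
    then obtain a b c where abc: "{a, b, c} \<subseteq> V'" "a \<noteq> b" "b \<noteq> c" "a \<noteq> c"
      by (auto simp: card_3_iff)
    then have "a \<in> f ` ?P" "b \<in> f ` ?P" "c \<in> f ` ?P"
      using V'(1) unfolding V_def by blast+
    then obtain A B C where ABC: "a = f A" "b = f B" "c = f C" "{A, B, C} \<subseteq> ?P"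
      by blast
    then have "A \<noteq> B" "B \<noteq> C" "A \<noteq> C"
      using abc by auto
    then obtain S T i j where ST: "S \<in> {A, B, C}" "T \<in> {A, B, C}"
      and ij: "(i \<in> S) \<noteq> (i \<in> T)" "(j \<in> S) \<noteq> (j \<in> T)" "i \<noteq> j"
      by (rule three_sets_differ_twice)
    define h where "h = ternary_sum (flip_sign i)"
    \<comment> \<open>The competing map decodes a point of \<open>V\<close> to its subset and
      re-encodes it with place \<open>i\<close> negated, where \<open>i\<close> is one of two
      coordinates separating \<open>S\<close> from \<open>T\<close>.\<close>
    define g where "g = h \<circ> inv_into ?P f"
    have g: "g (f A) = h A" if "A \<in> ?P" for A
      using that inj by (simp add: g_def)
    have "inj_on h ?P"
      unfolding h_def by (rule inj_on_ternary_sum) (simp add: flip_sign_def)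
    then have "inj_on g V"
      using g by (auto simp: V_def inj_on_def)
    moreover have "\<bar>g x - g y\<bar> = \<bar>x - y\<bar>" if "{x, y} \<in> E" for x y
    proof -
      obtain k A where kA: "k < N" "A \<subseteq> {..<N} - {k}" "{x, y} = {f A, f (insert k A)}"
        using \<open>{x, y} \<in> E\<close> by (auto simp: E_def cube_edges_def)
      then have "finite A" "k \<notin> A"
        by (auto intro: finite_subset)
      then have "\<bar>h (insert k A) - h A\<bar> = \<bar>f (insert k A) - f A\<bar>"
        unfolding h_def f_def by (simp add: ternary_sum_insert_diff flip_sign_def)
      moreover have "g (f A) = h A" "g (f (insert k A)) = h (insert k A)"
        using kA by (auto intro!: g)
      ultimately show ?thesis
        using kA(3) by (auto simp: doubleton_eq_iff abs_minus_commute)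
    qed
    ultimately have "\<bar>g u - g v\<bar> = \<bar>u - v\<bar>" if "u \<in> V'" "v \<in> V'" for u v
      using rec that unfolding reconstructible_def by blast
    moreover have "f S \<in> V'" "f T \<in> V'"
      using ST ABC abc by auto
    moreover have "S \<in> ?P" "T \<in> ?P"
      using ST ABC by auto
    ultimately have "\<bar>h S - h T\<bar> = \<bar>f S - f T\<bar>"
      using g by metis
    then show False
      using ternary_sum_flip_sign_neq[of S N T i j] \<open>S \<in> ?P\<close> \<open>T \<in> ?P\<close> ij
      by (simp add: h_def f_def)
  qed
  ultimately show ?thesis
    by blast
qed

end
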